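(* Let $G$ be a graph whose tree-width is at most $2$. Then $\vec{\chi}(G)\le 10$.
   Context: All graphs are finite and simple. An orientation of $G$ chooses a direction for each edge; $d^+(v)$ is the number of edges directed out of $v$. An orientation is proper if $d^+(u)\neq d^+(v)$ for every edge $uv$. The proper orientation number $\vec{\chi}(G)$ is the minimum, over all proper orientations of $G$, of $\max_{v\in V(G)} d^+(v)$ (every graph has a proper orientation). *)

theory Defs
  imports "Graph_Theory.Graph_Theory"
begin

text \<open>
  A finite simple graph is a \<^locale>\<open>pair_graph\<close>: a finite, loop-free, symmetric digraph
  without parallel arcs, in which the edge joining \<open>u\<close> and \<open>v\<close> is the pair of arcs \<open>(u, v)\<close>
  and \<open>(v, u)\<close>.
\<close>

section \<open>Proper orientations\<close>

definition orientation_of :: "'a pair_pre_digraph \<Rightarrow> 'a pair_pre_digraph \<Rightarrow> bool" where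
  "orientation_of G D \<longleftrightarrow>
     pverts D = pverts G \<and> parcs D \<subseteq> parcs G \<and>
     (\<forall>(u, v) \<in> parcs G. (u, v) \<in> parcs D \<longleftrightarrow> (v, u) \<notin> parcs D)"

definition proper_orientation_of :: "'a pair_pre_digraph \<Rightarrow> 'a pair_pre_digraph \<Rightarrow> bool" where
  "proper_orientation_of G D \<longleftrightarrow>
     orientation_of G D \<and>
     (\<forall>(u, v) \<in> parcs G. out_degree (with_proj D) u \<noteq> out_degree (with_proj D) v)"

text \<open>Inserting \<open>0\<close> only matters for the graph without vertices, where it gives the value \<open>0\<close>.\<close>

definition max_out_degree :: "'a pair_pre_digraph \<Rightarrow> nat" where
  "max_out_degree D = Max (insert 0 (out_degree (with_proj D) ` pverts D))"

definition proper_orientation_number :: "'a pair_pre_digraph \<Rightarrow> nat" where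
  "proper_orientation_number G =
     (LEAST k. \<exists>D. proper_orientation_of G D \<and> max_out_degree D = k)"

section \<open>Tree-width\<close>

text \<open>
  The library's \<^const>\<open>tree\<close> forbids directed cycles, so it rejects every symmetric digraph
  with an edge (its two arcs form a directed cycle of length 2) and accepts, say, the
  transitive triangle. In a symmetric loop-free digraph the cycles of the underlying simple
  graph are exactly the directed cycles of length at least 3.
\<close>

definition undirected_tree :: "'b pair_pre_digraph \<Rightarrow> bool" where
  "undirected_tree T \<longleftrightarrow>
     pair_graph T \<and> connected (with_proj T) \<and>
     \<not> (\<exists>p. pre_digraph.cycle (with_proj T) p \<and> length p \<ge> 3)"

text \<open>
  The decomposition tree has natural numbers as nodes, which covers all finite trees up to
  isomorphism. It is nonempty and each vertex of \<open>G\<close> occurs in some bag, because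
  \<^const>\<open>connected\<close> excludes the graph without vertices.
\<close>

definition tree_decomposition ::
  "'a pair_pre_digraph \<Rightarrow> nat pair_pre_digraph \<Rightarrow> (nat \<Rightarrow> 'a set) \<Rightarrow> bool" where
  "tree_decomposition G T X \<longleftrightarrow>
     undirected_tree T \<and>
     (\<Union>t \<in> pverts T. X t) = pverts G \<and>
     (\<forall>(u, v) \<in> parcs G. \<exists>t \<in> pverts T. u \<in> X t \<and> v \<in> X t) \<and>
     (\<forall>v \<in> pverts G. connected (with_proj T \<restriction> {t \<in> pverts T. v \<in> X t}))"

definition decomposition_width :: "nat pair_pre_digraph \<Rightarrow> (nat \<Rightarrow> 'a set) \<Rightarrow> int" where
  "decomposition_width T X = Max ((\<lambda>t. int (card (X t)) - 1) ` pverts T)"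

definition tree_width :: "'a pair_pre_digraph \<Rightarrow> int" where
  "tree_width G = (LEAST w. \<exists>T X. tree_decomposition G T X \<and> decomposition_width T X = w)"

text \<open>The minimum over an integer-valued width exists.\<close>

lemma tree_decomposition_single:
  "tree_decomposition G \<lparr>pverts = {0}, parcs = {}\<rparr> (\<lambda>_. pverts G)" if "pair_graph G"
proof -
  interpret pair_graph G by fact
  let ?T = "\<lparr>pverts = {0::nat}, parcs = {}\<rparr>"
  have g: "pair_graph ?T"
    by unfold_locales (auto simp: symmetric_def)
  have c: "connected (with_proj ?T)"
    by (auto simp: connected_def mk_symmetric_def strongly_connected_def reachable_def
        intro: rtrancl_on.intros)
  have n: "\<not> pre_digraph.cycle (with_proj ?T) p" for p
    by (auto simp: pre_digraph.cycle_def pre_digraph.awalk_def)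
  have r: "with_proj ?T \<restriction> {0} = with_proj ?T"
    by (simp add: induce_subgraph_def with_proj_def)
  have "{t \<in> pverts ?T. v \<in> pverts G} = {0}" if "v \<in> pverts G" for v
    using that by auto
  then have "connected (with_proj ?T \<restriction> {t \<in> pverts ?T. v \<in> pverts G})" if "v \<in> pverts G" for v
    using that c r by metis
  then show ?thesis
    using g c n in_arcsD1 in_arcsD2
    unfolding tree_decomposition_def undirected_tree_def by auto
qed

lemma tree_width_attained:
  assumes "pair_graph G"
  shows "\<exists>T X. tree_decomposition G T X \<and> decomposition_width T X = tree_width G"
proof -
  let ?P = "\<lambda>w. \<exists>T X. tree_decomposition G T X \<and> decomposition_width T X = w"
  have ge: "w \<ge> -1" if P: "?P w" for w
  proof -
    from P obtain T :: "nat pair_pre_digraph" and X :: "nat \<Rightarrow> 'a set"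
      where d: "tree_decomposition G T X" and w: "decomposition_width T X = w" by blast
    have "pair_graph T" and "connected (with_proj T)"
      using d by (auto simp: tree_decomposition_def undirected_tree_def)
    then have fin: "finite (pverts T)" and ne: "pverts T \<noteq> {}"
      by (auto simp: pair_graph_def pair_digraph_def pair_fin_digraph_def
          pair_fin_digraph_axioms_def connected_def strongly_connected_def mk_symmetric_def)
    from ne obtain t where "t \<in> pverts T" by blast
    then have "int (card (X t)) - 1 \<le> w"
      using fin unfolding w[symmetric] decomposition_width_def by (intro Max_ge) auto
    then show ?thesis by linarith
  qed
  obtain w0 where w0: "?P w0" using tree_decomposition_single[OF assms] by blast
  define n where "n = (LEAST n. ?P (int n - 1))"
  have ex: "?P (int (nat (w0 + 1)) - 1)" using w0 ge[OF w0] by simp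
  have n: "?P (int n - 1)" unfolding n_def by (rule LeastI[of "\<lambda>n. ?P (int n - 1)", OF ex])
  have "tree_width G = int n - 1" unfolding tree_width_def
  proof (rule Least_equality)
    show "?P (int n - 1)" by (rule n)
  next
    fix w assume w: "?P w"
    then have "?P (int (nat (w + 1)) - 1)" using ge[OF w] by simp
    then have "n \<le> nat (w + 1)" unfolding n_def by (rule Least_le)
    then show "int n - 1 \<le> w" using ge[OF w] by linarith
  qed
  with n show ?thesis by simp
qed

end

theory Submission
  imports Defs
begin

text \<open>
  Read along a tree decomposition of width 2, the vertices of \<open>G\<close> can be ordered and coloured with
  three colours so that the neighbours of a vertex that precede it (its parents) have pairwise
  different colours, all different from its own (\<open>rainbow_order_of_tree_decomposition\<close>). So a vertex
  has at most two parents, and two vertices of the same colour have no common child.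

  The orientation is built in rounds. A round selects an independent set \<open>J\<close> of vertices that are
  not yet settled and directs all remaining edges at \<open>J\<close> in such a way that every vertex of \<open>J\<close>
  gets the same outdegree \<open>l\<close>, where \<open>l\<close> is used in no other round; then the orientation is proper
  whatever the rounds are. What has to be controlled is that the unsettled vertices can still be
  handled with small values. The potential of an unsettled vertex is the largest outdegree that it
  can still reach, namely its degree minus the number of its edges already directed towards it. In a
  round with value \<open>l\<close>, a selected vertex of potential \<open>p\<close> directs \<open>p - l\<close> of its remaining edges to
  itself and all others away from itself, and each of the latter lowers the potential of its other
  end. The edges directed to a selected vertex always come from its children (later neighbours).
  Hence an edge directed from an unsettled vertex to a settled one always leads to a parent, and an
  unsettled vertex of potential \<open>p\<close> has at least \<open>p - 2\<close> unsettled children to choose from.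

  The first three rounds select, in colour 0, 1 and 2, all vertices of potential at least 8, 9 and 10
  and give them exactly these values (\<open>settle_colour_class\<close>). The remaining potentials are at most 7,
  8 and 9. If they were all at most some \<open>l\<close>, one could select a maximal independent set of vertices
  of potential \<open>l\<close>: all other vertices would drop below \<open>l\<close>, and continuing with \<open>l - 1\<close> would finish
  the orientation with values at most \<open>l\<close> (\<open>settle_all\<close>). The heart of the proof, \<open>settle_level\<close>, is
  that this also works when one colour class is allowed to exceed \<open>l\<close> by a small excess \<open>e\<close> with
  \<open>2 * e + 2 \<le> l\<close>; the independent set then has to be chosen with maximum weight, where the weight
  grows with the excess. It is applied to colour 2 with \<open>l = 7\<close> and to colour 1 with \<open>l = 6\<close>, the
  excess being at most 2 in both cases. After that all potentials are at most 5.
\<close>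

section \<open>Subtrees of a tree\<close>

lemma pcas_append_Cons:
  "pcas u p a \<Longrightarrow> pcas b q v \<Longrightarrow> pcas u (p @ (a, b) # q) v"
  by (induction p arbitrary: u) auto

lemma pawalk_verts_append_Cons:
  "pcas u p a \<Longrightarrow> pawalk_verts u (p @ (a, b) # q) = pawalk_verts u p @ pawalk_verts b q"
  by (induction p arbitrary: u) auto

lemma pcas_suffix:
  assumes "x \<in> set (pawalk_verts y p)" "pcas y p b" "distinct (pawalk_verts y p)"
  shows "\<exists>q. pcas x q b \<and> set q \<subseteq> set p \<and> distinct (pawalk_verts x q) \<and>
    set (pawalk_verts x q) \<subseteq> set (pawalk_verts y p)"
  using assms
proof (induction p arbitrary: y)
  case Nil
  then show ?case by (intro exI[of _ "[]"]) auto
next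
  case (Cons e p)
  show ?case
  proof (cases "x = y")
    case True
    then show ?thesis using Cons.prems by (intro exI[of _ "e # p"]) auto
  next
    case False
    then have "x \<in> set (pawalk_verts (snd e) p)" using Cons.prems by auto
    from Cons.IH[OF this] Cons.prems show ?thesis by auto
  qed
qed

lemma rtrancl_on_simple_path:
  assumes "(x, y) \<in> rtrancl_on A E"
  shows "\<exists>p. pcas x p y \<and> set p \<subseteq> E \<and> distinct (pawalk_verts x p) \<and> set (pawalk_verts x p) \<subseteq> A"
  using assms
proof (induction rule: converse_rtrancl_on_induct)
  case base
  then show ?case by (intro exI[of _ "[]"]) auto
next
  case (step x z)
  then obtain p where p: "pcas z p y" "set p \<subseteq> E" "distinct (pawalk_verts z p)"
    "set (pawalk_verts z p) \<subseteq> A" by blast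
  show ?case
  proof (cases "x \<in> set (pawalk_verts z p)")
    case True
    from pcas_suffix[OF this p(1,3)] p show ?thesis by blast
  next
    case False
    then show ?thesis using p step by (intro exI[of _ "(x, z) # p"]) auto
  qed
qed

text \<open>
  If \<open>S\<close> is connected, a component of \<open>T - S\<close> is joined to \<open>S\<close> by a single edge: with two such edges,
  a path in the component and a path in \<open>S\<close> close up to a cycle.
\<close>

lemma undirected_tree_cut:
  assumes T: "undirected_tree T"
    and out: "(t, q) \<in> rtrancl_on (pverts T - S) (parcs T)" and qs: "(q, s') \<in> parcs T"
    and ins: "(s', s) \<in> rtrancl_on S (parcs T)" and st: "(s, t) \<in> parcs T"
  shows "q = t \<and> s' = s"
proof -
  obtain p1 where p1: "pcas t p1 q" "set p1 \<subseteq> parcs T" "distinct (pawalk_verts t p1)"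
    "set (pawalk_verts t p1) \<subseteq> pverts T - S"
    using rtrancl_on_simple_path[OF out] by blast
  obtain p2 where p2: "pcas s' p2 s" "set p2 \<subseteq> parcs T" "distinct (pawalk_verts s' p2)"
    "set (pawalk_verts s' p2) \<subseteq> S"
    using rtrancl_on_simple_path[OF ins] by blast
  define p where "p = p1 @ (q, s') # (p2 @ (s, t) # [])"
  have v: "pawalk_verts t p = pawalk_verts t p1 @ pawalk_verts s' p2 @ [t]"
    unfolding p_def using p1(1) p2(1) by (simp add: pawalk_verts_append_Cons)
  obtain vs where vs: "pawalk_verts t p1 = t # vs"
    using p1(1) by (cases p1) auto
  have "pcas t p t"
    unfolding p_def using p1(1) p2(1) by (intro pcas_append_Cons) auto
  moreover have "t \<in> pverts T" using p1(4) vs by auto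
  moreover have "set p \<subseteq> parcs T" using p1 p2 qs st by (auto simp: p_def)
  moreover have "distinct (tl (pawalk_verts t p))"
    unfolding v using p1 p2 vs by auto
  ultimately have "pre_digraph.cycle (with_proj T) p"
    unfolding pre_digraph.cycle_def pre_digraph.awalk_def cas_with_proj_eq awalk_verts_with_proj_eq
    by (intro exI[of _ t]) (auto simp: p_def)
  then have "length p < 3" using T by (auto simp: undirected_tree_def)
  then have "p1 = []" "p2 = []" by (auto simp: p_def)
  then show ?thesis using p1 p2 by auto
qed

lemma connected_rtrancl_on:
  assumes "pair_graph T" "connected (with_proj T \<restriction> A)" "x \<in> A" "y \<in> A"
  shows "(x, y) \<in> rtrancl_on A (parcs T)"
proof -
  interpret pair_graph T by fact
  let ?H = "mk_symmetric (with_proj T \<restriction> A)"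
  have v: "verts (with_proj ?H) = A" by (simp add: mk_symmetric_def)
  have "(x, y) \<in> rtrancl_on A (arcs_ends (with_proj ?H))"
    using assms v unfolding connected_def strongly_connected_def reachable_def by metis
  moreover have "arcs_ends (with_proj ?H) \<subseteq> parcs T"
    by (auto simp: parcs_mk_symmetric intro: arcs_symmetric)
  ultimately show ?thesis by (rule rtrancl_on_mono[rotated 2]) auto
qed

text \<open>
  The next two facts locate where a walk crosses the boundary of \<open>S\<close>. The first one finds a node of
  the tree by which a subtree can grow, the second one the edge to which
  \<open>undirected_tree_cut\<close> is applied.
\<close>

lemma rtrancl_on_leaving:
  assumes "(x, y) \<in> rtrancl_on A E" "x \<in> S" "y \<notin> S"
  obtains s t where "s \<in> S" "t \<in> A - S" "(s, t) \<in> E"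
  using assms by (induction rule: rtrancl_on_induct) auto

lemma rtrancl_on_entering:
  assumes "(x, y) \<in> rtrancl_on A E" "x \<notin> S" "y \<in> S"
  obtains q s where "(x, q) \<in> rtrancl_on (A - S) E" "(q, s) \<in> E" "s \<in> S \<inter> A"
proof -
  have "(y \<notin> S \<longrightarrow> (x, y) \<in> rtrancl_on (A - S) E \<or>
      (\<exists>q s. (x, q) \<in> rtrancl_on (A - S) E \<and> (q, s) \<in> E \<and> s \<in> S \<inter> A)) \<and>
    (y \<in> S \<longrightarrow> (\<exists>q s. (x, q) \<in> rtrancl_on (A - S) E \<and> (q, s) \<in> E \<and> s \<in> S \<inter> A))"
    using assms(1)
  proof (induction rule: rtrancl_on_induct)
    case base then show ?case using assms(2) by auto
  next
    case (step y z)
    then show ?case by (blast intro: rtrancl_on_into_rtrancl_on)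
  qed
  then show thesis using assms(3) that by blast
qed

section \<open>Rainbow orderings\<close>

text \<open>
  The last condition speaks of all pairs of vertices in a common bag, whether they are adjacent or
  not. It thus describes the chordal graph in which every bag is a clique, and does
  not change for the old vertices when a bag is added that meets them inside an old bag.
\<close>

definition rainbow_order_on :: "(nat \<Rightarrow> 'a set) \<Rightarrow> nat set \<Rightarrow> ('a \<Rightarrow> nat) \<Rightarrow> ('a \<Rightarrow> nat) \<Rightarrow> bool" where
  "rainbow_order_on X S r c \<longleftrightarrow>
     inj_on r (\<Union>(X ` S)) \<and> (\<forall>v \<in> \<Union>(X ` S). c v < 3) \<and> (\<forall>s\<in>S. inj_on c (X s)) \<and>
     (\<forall>s\<in>S. \<forall>s'\<in>S. \<forall>v \<in> X s \<inter> X s'. \<forall>u \<in> X s. \<forall>u' \<in> X s'.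
        r u < r v \<longrightarrow> r u' < r v \<longrightarrow> c u = c u' \<longrightarrow> u = u')"

text \<open>
  The vertices that first occur in the new bag \<open>X t\<close> are ranked above all old ones, and receive
  different colours not used on the old part of the bag. The old part lies inside an old bag, so its
  colours are already different, and no two old vertices come together for the first time.
\<close>

lemma rainbow_order_on_insert:
  assumes R: "rainbow_order_on X S r c"
    and fin: "finite (\<Union>(X ` S))" "finite (X t)" "card (X t) \<le> 3"
    and att: "S = {} \<or> (\<exists>s\<in>S. X t \<inter> \<Union>(X ` S) \<subseteq> X s)"
  shows "\<exists>r c. rainbow_order_on X (insert t S) r c"
proof -
  define W where "W = \<Union>(X ` S)"
  define B where "B = X t \<inter> W"
  define D where "D = X t - W"
  have rW: "inj_on r W" and cW: "\<And>v. v \<in> W \<Longrightarrow> c v < 3" and cX: "\<And>s. s \<in> S \<Longrightarrow> inj_on c (X s)"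
    using R by (auto simp: rainbow_order_on_def W_def)
  have rb: "u = u'" if "s \<in> S" "s' \<in> S" "v \<in> X s" "v \<in> X s'" "u \<in> X s" "u' \<in> X s'"
    "r u < r v" "r u' < r v" "c u = c u'" for s s' u u' v
    using R that unfolding rainbow_order_on_def by blast
  have att': "B = {} \<or> (\<exists>s\<in>S. B \<subseteq> X s)" using att by (auto simp: B_def W_def)
  then have cB: "inj_on c B" using cX inj_on_subset by blast
  have finBD: "finite B" "finite D" using fin by (auto simp: B_def D_def)
  have "card (X t) = card B + card D"
    unfolding B_def D_def using fin(2) by (metis card_Int_Diff)
  moreover have "card ({..<3} - c ` B) = 3 - card B"
    using cW finBD cB by (subst card_Diff_subset) (auto simp: B_def card_image)
  ultimately have "card D \<le> card ({..<3} - c ` B)" using fin(3) by simp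
  then obtain f where f: "f ` D \<subseteq> {..<3} - c ` B" "inj_on f D"
    using card_le_inj[of D "{..<3} - c ` B"] finBD by auto
  obtain g :: "'a \<Rightarrow> nat" where g: "inj_on g D"
    using finite_imp_inj_to_nat_seg[OF finBD(2)] by blast
  \<comment> \<open>every old rank is below \<open>m\<close>, every new rank will be at least \<open>m\<close>\<close>
  define m where "m = Suc (Max (insert 0 (r ` W)))"
  have m: "r v < m" if "v \<in> W" for v
    using that fin(1) by (auto simp: m_def W_def less_Suc_eq_le)
  define r' where "r' v = (if v \<in> D then m + g v else r v)" for v
  define c' where "c' v = (if v \<in> D then f v else c v)" for v
  have DW: "v \<notin> D" if "v \<in> W" for v using that by (auto simp: D_def)
  have U: "\<Union>(X ` insert t S) = W \<union> D" by (auto simp: W_def D_def)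
  have ct: "inj_on c' (X t)"
  proof -
    have "X t = B \<union> D" by (auto simp: B_def D_def)
    moreover have "inj_on c' B" using cB by (auto simp: c'_def B_def D_def inj_on_def)
    moreover have "inj_on c' D" using f by (auto simp: c'_def inj_on_def)
    moreover have "c' ` B \<inter> c' ` D = {}"
    proof -
      have "c' ` B = c ` B" by (auto simp: c'_def B_def D_def)
      moreover have "c' ` D = f ` D" by (auto simp: c'_def)
      ultimately show ?thesis using f(1) by auto
    qed
    ultimately show ?thesis by (simp add: inj_on_Un) blast
  qed
  have XW: "X s \<subseteq> W" if "s \<in> S" for s using that by (auto simp: W_def)
  have "rainbow_order_on X (insert t S) r' c'"
    unfolding rainbow_order_on_def U
  proof (intro conjI ballI impI)
    show "inj_on r' (W \<union> D)"
    proof (rule inj_onI)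
      fix x y assume xy: "x \<in> W \<union> D" "y \<in> W \<union> D" "r' x = r' y"
      show "x = y"
      proof (cases "x \<in> D"; cases "y \<in> D")
        assume "x \<in> D" "y \<in> D"
        then show ?thesis using xy(3) inj_onD[OF g, of x y] by (simp add: r'_def)
      next
        assume "x \<in> D" "y \<notin> D"
        then show ?thesis using xy m[of y] by (simp add: r'_def)
      next
        assume "x \<notin> D" "y \<in> D"
        then show ?thesis using xy m[of x] by (simp add: r'_def)
      next
        assume "x \<notin> D" "y \<notin> D"
        then show ?thesis using xy inj_onD[OF rW, of x y] by (simp add: r'_def)
      qed
    qed
  next
    fix v assume "v \<in> W \<union> D"
    then show "c' v < 3" using cW f(1) DW by (auto simp: c'_def)
  next
    fix s assume "s \<in> insert t S"
    then show "inj_on c' (X s)"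
    proof
      assume "s = t" then show ?thesis using ct by simp
    next
      assume s: "s \<in> S"
      have "inj_on c' (X s) = inj_on c (X s)"
        by (rule inj_on_cong) (use XW[OF s] DW in \<open>auto simp: c'_def\<close>)
      then show ?thesis using cX[OF s] by simp
    qed
  next
    fix s1 s2 v u u'
    assume s1: "s1 \<in> insert t S" and s2: "s2 \<in> insert t S" and v: "v \<in> X s1 \<inter> X s2"
      and u: "u \<in> X s1" and u': "u' \<in> X s2"
      and lt: "r' u < r' v" and lt': "r' u' < r' v" and eq: "c' u = c' u'"
    show "u = u'"
    proof (cases "v \<in> D")
      case True
      then have "s1 = t" "s2 = t" using s1 s2 v XW DW by auto
      then show ?thesis using ct u u' eq by (auto dest: inj_onD)
    next
      case False
      then have vW: "v \<in> W" using v s1 XW by (auto simp: D_def)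
      have old: "w \<notin> D" if "r' w < r' v" for w
        using that m[OF vW] False by (auto simp: r'_def)
      \<comment> \<open>two old vertices that meet in \<open>X t\<close> have met in an old bag, so the claim is inherited\<close>
      have home: "\<exists>s\<in>S. v \<in> X s \<and> w \<in> X s"
        if "s \<in> insert t S" "v \<in> X s" "w \<in> X s" "w \<notin> D" for s w
      proof (cases "s = t")
        case True
        then have "v \<in> B" "w \<in> B" using that False by (auto simp: B_def D_def)
        then show ?thesis using att' by auto
      next
        case False
        then show ?thesis using that by auto
      qed
      obtain a where a: "a \<in> S" "v \<in> X a" "u \<in> X a" using home[OF s1 _ u old[OF lt]] v by auto
      obtain b where b: "b \<in> S" "v \<in> X b" "u' \<in> X b" using home[OF s2 _ u' old[OF lt']] v by auto
      show ?thesis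
        by (rule rb[OF a(1) b(1) a(2) b(2) a(3) b(3)])
          (use lt lt' eq old[OF lt] old[OF lt'] False in \<open>auto simp: r'_def c'_def\<close>)
    qed
  qed
  then show ?thesis by blast
qed

text \<open>
  Take a maximal subtree on whose bags such an order exists. If it is not the whole tree, it has a
  neighbouring node \<open>t\<close>. A vertex of \<open>X t\<close> that also lies in a bag of the subtree spans a connected set
  of nodes, which by \<open>undirected_tree_cut\<close> can reach the subtree from \<open>t\<close> only through the neighbour
  \<open>s\<close> of \<open>t\<close>; so it lies in \<open>X s\<close>, and the order extends to \<open>t\<close>.
\<close>

lemma rainbow_order_of_tree_decomposition:
  assumes dec: "tree_decomposition G T X" and fin: "finite (pverts G)"
    and width: "\<And>t. t \<in> pverts T \<Longrightarrow> card (X t) \<le> 3"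
  shows "\<exists>r c. rainbow_order_on X (pverts T) r c"
proof -
  have T: "undirected_tree T" and cov: "(\<Union>t \<in> pverts T. X t) = pverts G"
    and sub: "\<And>v. v \<in> pverts G \<Longrightarrow> connected (with_proj T \<restriction> {t \<in> pverts T. v \<in> X t})"
    using dec by (auto simp: tree_decomposition_def)
  have pT: "pair_graph T" and cT: "connected (with_proj T)" using T by (auto simp: undirected_tree_def)
  interpret T: pair_graph T by fact
  have "with_proj T \<restriction> pverts T = with_proj T"
    using T.in_arcsD1 T.in_arcsD2 by (auto simp: induce_subgraph_def with_proj_def)
  then have conT: "(x, y) \<in> rtrancl_on (pverts T) (parcs T)" if "x \<in> pverts T" "y \<in> pverts T" for x y
    using connected_rtrancl_on[OF pT _ that] cT by simp
  define good where "good S \<longleftrightarrow> S \<subseteq> pverts T \<and> S \<noteq> {} \<and>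
    (\<forall>x\<in>S. \<forall>y\<in>S. (x, y) \<in> rtrancl_on S (parcs T)) \<and> (\<exists>r c. rainbow_order_on X S r c)" for S
  have finX: "finite (\<Union>(X ` S))" if "S \<subseteq> pverts T" for S
    by (rule finite_subset[OF _ fin]) (use that cov in blast)
  have finXt: "finite (X t)" if "t \<in> pverts T" for t
    by (rule finite_subset[OF _ fin]) (use that cov in blast)
  have "pverts T \<noteq> {}" using cT by (auto simp: connected_def strongly_connected_def mk_symmetric_def)
  then obtain t0 where t0: "t0 \<in> pverts T" by blast
  have "rainbow_order_on X {} (\<lambda>_. 0) (\<lambda>_. 0)" by (simp add: rainbow_order_on_def)
  then have "\<exists>r c. rainbow_order_on X {t0} r c"
    by (rule rainbow_order_on_insert) (use t0 finXt width in auto)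
  then have "good {t0}" using t0 by (auto simp: good_def)
  moreover have "finite {S. good S}"
    by (rule finite_subset[of _ "Pow (pverts T)"]) (use T.pair_finite_verts in \<open>auto simp: good_def\<close>)
  ultimately obtain S where S: "good S" and max: "\<And>S'. good S' \<Longrightarrow> S \<subseteq> S' \<Longrightarrow> S = S'"
    using finite_has_maximal[of "{S. good S}"] by blast
  have Sv: "S \<subseteq> pverts T" and Sne: "S \<noteq> {}"
    and Scon: "\<And>x y. x \<in> S \<Longrightarrow> y \<in> S \<Longrightarrow> (x, y) \<in> rtrancl_on S (parcs T)"
    and SR: "\<exists>r c. rainbow_order_on X S r c"
    using S by (auto simp: good_def)
  have "S = pverts T"
  proof (rule ccontr)
    assume "S \<noteq> pverts T"
    then obtain x y where "x \<in> S" "y \<in> pverts T" "y \<notin> S" using Sv Sne by blast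
    then obtain s t where st: "s \<in> S" "t \<in> pverts T - S" "(s, t) \<in> parcs T"
      using rtrancl_on_leaving[OF conT[of x y], of S] Sv by blast
    have ts: "(t, s) \<in> parcs T" using T.arcs_symmetric[OF st(3)] .
    have mono: "(x, y) \<in> rtrancl_on (insert t S) (parcs T)" if "x \<in> S" "y \<in> S" for x y
      using Scon[OF that] by (rule rtrancl_on_mono[rotated 2]) auto
    have edge: "(t, s) \<in> rtrancl_on (insert t S) (parcs T)" "(s, t) \<in> rtrancl_on (insert t S) (parcs T)"
      using st ts by (intro rtrancl_on_into_rtrancl_on[OF rtrancl_on_refl]; blast)+
    have to_s: "(x, s) \<in> rtrancl_on (insert t S) (parcs T)" if "x \<in> insert t S" for x
      using that edge(1) mono[of x s] st(1) by blast
    have from_s: "(s, y) \<in> rtrancl_on (insert t S) (parcs T)" if "y \<in> insert t S" for y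
      using that edge(2) mono[of s y] st(1) by blast
    have con: "\<forall>x\<in>insert t S. \<forall>y\<in>insert t S. (x, y) \<in> rtrancl_on (insert t S) (parcs T)"
      by (intro ballI rtrancl_on_trans[OF to_s from_s])
    have att: "X t \<inter> \<Union>(X ` S) \<subseteq> X s"
    proof
      fix v assume "v \<in> X t \<inter> \<Union>(X ` S)"
      then obtain s0 where v: "v \<in> X t" "s0 \<in> S" "v \<in> X s0" by blast
      let ?A = "{t \<in> pverts T. v \<in> X t}"
      have "v \<in> pverts G" using v(1) st(2) cov by auto
      then have "(t, s0) \<in> rtrancl_on ?A (parcs T)"
        by (rule connected_rtrancl_on[OF pT sub]) (use v st(2) Sv in auto)
      then obtain q s' where q: "(t, q) \<in> rtrancl_on (?A - S) (parcs T)" "(q, s') \<in> parcs T"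
        "s' \<in> S \<inter> ?A"
        using rtrancl_on_entering[of t s0 ?A "parcs T" S] st(2) v(2) by blast
      have "(t, q) \<in> rtrancl_on (pverts T - S) (parcs T)"
        using q(1) by (rule rtrancl_on_mono[rotated 2]) auto
      then have "s' = s"
        using undirected_tree_cut[OF T _ q(2) Scon st(3)] q(3) st(1) by blast
      then show "v \<in> X s" using q(3) by auto
    qed
    obtain r c where "rainbow_order_on X S r c" using SR by blast
    then have "\<exists>r c. rainbow_order_on X (insert t S) r c"
      by (rule rainbow_order_on_insert) (use finX[OF Sv] finXt width st att in auto)
    then have "good (insert t S)" using con Sv st(2) by (auto simp: good_def)
    then show False using max[of "insert t S"] st(2) by auto
  qed
  then show ?thesis using SR by simp
qed

section \<open>Partial orientations and their completion\<close>

text \<open>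
  The neighbours of smaller rank \<open>r\<close> are the parents of a vertex. By the last assumption, each child
  has at most one parent of any given colour. In \<open>settle_level\<close> this prevents
  two vertices of the same colour from competing for a child.
\<close>

locale rainbow_ordered_graph =
  fixes V :: "'a set" and E :: "'a rel" and r :: "'a \<Rightarrow> nat" and c :: "'a \<Rightarrow> nat"
  assumes finite_V: "finite V"
    and E_sub: "E \<subseteq> V \<times> V"
    and E_sym: "(u, v) \<in> E \<Longrightarrow> (v, u) \<in> E"
    and inj_r: "inj_on r V"
    and colour_lt: "v \<in> V \<Longrightarrow> c v < 3"
    and colour_proper: "(u, v) \<in> E \<Longrightarrow> c u \<noteq> c v"
    and parents_rainbow: "(u, v) \<in> E \<Longrightarrow> (u', v) \<in> E \<Longrightarrow> r u < r v \<Longrightarrow> r u' < r v \<Longrightarrow>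
      c u = c u' \<Longrightarrow> u = u'"
begin

text \<open>
  For a set \<open>A\<close> of directed edges, the potential counts the edges at \<open>u\<close> that are not directed towards
  \<open>u\<close>: those directed away from \<open>u\<close> and the undirected ones. Once all edges at \<open>u\<close> have a direction, it
  is the outdegree of \<open>u\<close>, so one notion serves for settled and unsettled vertices.
\<close>

definition potential :: "'a rel \<Rightarrow> 'a \<Rightarrow> nat" where
  "potential A u = card {v. (u, v) \<in> E \<and> (v, u) \<notin> A}"

text \<open>
  An intermediate stage: exactly the edges meeting the set \<open>P\<close> of settled vertices have
  a direction, listed in \<open>A\<close>. The fifth clause says that an unsettled vertex has edges directed away
  from it only to parents. The set \<open>F\<close> records the outdegrees that have been given out, so that an
  independent set of vertices with a value outside \<open>F\<close> cannot violate properness.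
\<close>

definition settled :: "'a set \<Rightarrow> 'a rel \<Rightarrow> nat set \<Rightarrow> bool" where
  "settled P A F \<longleftrightarrow> P \<subseteq> V \<and> A \<subseteq> E \<and>
     (\<forall>u v. (u, v) \<in> E \<longrightarrow> u \<in> P \<or> v \<in> P \<longrightarrow> ((u, v) \<in> A \<longleftrightarrow> (v, u) \<notin> A)) \<and>
     (\<forall>u v. (u, v) \<in> A \<longrightarrow> u \<in> P \<or> v \<in> P) \<and>
     (\<forall>u v. (u, v) \<in> A \<longrightarrow> u \<notin> P \<longrightarrow> r v < r u) \<and>
     (\<forall>u v. (u, v) \<in> E \<longrightarrow> u \<in> P \<longrightarrow> v \<in> P \<longrightarrow> potential A u \<noteq> potential A v) \<and>
     potential A ` P \<subseteq> F"

definition kids :: "'a set \<Rightarrow> 'a \<Rightarrow> 'a set" where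
  "kids P j = {u \<in> V - P. (j, u) \<in> E \<and> r j < r u}"

definition indep :: "'a set \<Rightarrow> bool" where
  "indep J \<longleftrightarrow> (\<forall>u\<in>J. \<forall>v\<in>J. (u, v) \<notin> E)"

lemma finite_nbrs: "finite {v. (u, v) \<in> E \<and> Q v}"
  by (rule finite_subset[OF _ finite_V]) (use E_sub in auto)

lemma finite_kids: "finite (kids P j)"
  unfolding kids_def using finite_V by auto

lemma settled_empty: "settled {} {} {}"
  by (auto simp: settled_def)

text \<open>
  One round. The vertices \<open>j\<close> of \<open>J\<close> direct the edges to \<open>K j\<close> towards themselves and all other
  undirected edges away from themselves. Since \<open>J\<close> is independent, these choices do not interfere.
\<close>

lemma settle_independent_set:
  assumes st: "settled P A F" and J: "J \<subseteq> V - P" and ind: "indep J"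
    and K: "\<And>j. j \<in> J \<Longrightarrow> K j \<subseteq> kids P j"
    and val: "\<And>j. j \<in> J \<Longrightarrow> potential A j = l + card (K j)"
    and l: "l \<notin> F"
  obtains A' where "settled (P \<union> J) A' (insert l F)"
    and "\<And>u. u \<in> V - (P \<union> J) \<Longrightarrow>
      potential A' u + card {j \<in> J. (j, u) \<in> E \<and> u \<notin> K j} = potential A u"
proof -
  define A' where "A' = A \<union> {(j, u). j \<in> J \<and> u \<in> V - P \<and> (j, u) \<in> E \<and> u \<notin> K j}
    \<union> {(u, j). j \<in> J \<and> u \<in> K j}"
  have PV: "P \<subseteq> V" and AE: "A \<subseteq> E"
    using st by (simp_all add: settled_def)
  have dec: "(u, v) \<in> A \<longleftrightarrow> (v, u) \<notin> A" if "(u, v) \<in> E" "u \<in> P \<or> v \<in> P" for u v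
    using st that unfolding settled_def by blast
  have touch: "u \<in> P \<or> v \<in> P" if "(u, v) \<in> A" for u v
    using st that by (simp add: settled_def)
  have par: "r v < r u" if "(u, v) \<in> A" "u \<notin> P" for u v
    using st that by (simp add: settled_def)
  have separated: "potential A u \<noteq> potential A v" if "(u, v) \<in> E" "u \<in> P" "v \<in> P" for u v
    using st that by (simp add: settled_def)
  have vals: "potential A u \<in> F" if "u \<in> P" for u
    using st that by (auto simp: settled_def)
  have Kd: "u \<in> V - P \<and> (j, u) \<in> E \<and> r j < r u" if "j \<in> J" "u \<in> K j" for j u
    using K that by (auto simp: kids_def)
  have JJ: "(u, v) \<notin> E" if "u \<in> J" "v \<in> J" for u v
    using ind that by (auto simp: indep_def)
  have old: "(u, v) \<in> A' \<longleftrightarrow> (u, v) \<in> A" if "u \<in> P \<or> v \<in> P" for u v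
    using that J Kd by (auto simp: A'_def)
  have undecided: "(u, v) \<notin> A" if "u \<notin> P" "v \<notin> P" for u v
    using touch that by blast
  have KJ: "u \<notin> K j" if "j \<in> J" "u \<in> J" for j u
    using Kd[OF that(1)] JJ that by blast
  have outJ: "(j, v) \<in> A' \<longleftrightarrow> v \<notin> K j" if "j \<in> J" "(j, v) \<in> E" "v \<notin> P" for j v
  proof -
    have "j \<notin> P" "v \<in> V" "v \<notin> J" using that J JJ E_sub by auto
    then show ?thesis using that undecided KJ by (auto simp: A'_def)
  qed
  have inJ: "(v, j) \<in> A' \<longleftrightarrow> v \<in> K j" if "j \<in> J" "(j, v) \<in> E" "v \<notin> P" for j v
  proof -
    have "j \<notin> P" "v \<in> V" "v \<notin> J" using that J JJ E_sub by auto
    then show ?thesis using that undecided KJ by (auto simp: A'_def)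
  qed
  have potP: "potential A' u = potential A u" if "u \<in> P" for u
    using that old by (simp add: potential_def)
  have potJ: "potential A' j = l" if j: "j \<in> J" for j
  proof -
    have jP: "j \<notin> P" using j J by auto
    have "{v. (j, v) \<in> E \<and> (v, j) \<notin> A'} = {v. (j, v) \<in> E \<and> (v, j) \<notin> A} - K j"
    proof (intro set_eqI iffI)
      fix v assume "v \<in> {v. (j, v) \<in> E \<and> (v, j) \<notin> A'}"
      then show "v \<in> {v. (j, v) \<in> E \<and> (v, j) \<notin> A} - K j"
        using j by (auto simp: A'_def)
    next
      fix v assume v: "v \<in> {v. (j, v) \<in> E \<and> (v, j) \<notin> A} - K j"
      show "v \<in> {v. (j, v) \<in> E \<and> (v, j) \<notin> A'}"
        using v old[of v j] inJ[OF j, of v] by (cases "v \<in> P") auto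
    qed
    moreover have "K j \<subseteq> {v. (j, v) \<in> E \<and> (v, j) \<notin> A}"
      using Kd[OF j] touch jP by blast
    moreover have "finite (K j)" using K[OF j] finite_kids finite_subset by blast
    ultimately show ?thesis
      using val[OF j] by (simp add: potential_def card_Diff_subset)
  qed
  have potR: "potential A' u + card {j \<in> J. (j, u) \<in> E \<and> u \<notin> K j} = potential A u"
    if u: "u \<in> V - (P \<union> J)" for u
  proof -
    let ?C = "{j \<in> J. (j, u) \<in> E \<and> u \<notin> K j}"
    have 1: "{v. (u, v) \<in> E \<and> (v, u) \<notin> A} = {v. (u, v) \<in> E \<and> (v, u) \<notin> A'} \<union> ?C"
    proof (intro set_eqI iffI)
      fix v assume v: "v \<in> {v. (u, v) \<in> E \<and> (v, u) \<notin> A}"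
      show "v \<in> {v. (u, v) \<in> E \<and> (v, u) \<notin> A'} \<union> ?C"
        using v u Kd E_sym by (auto simp: A'_def)
    next
      fix v assume v: "v \<in> {v. (u, v) \<in> E \<and> (v, u) \<notin> A'} \<union> ?C"
      show "v \<in> {v. (u, v) \<in> E \<and> (v, u) \<notin> A}"
        using v u J touch E_sym by (auto simp: A'_def)
    qed
    have 2: "{v. (u, v) \<in> E \<and> (v, u) \<notin> A'} \<inter> ?C = {}"
      using u by (auto simp: A'_def)
    have 3: "finite ?C" using J finite_V by (auto intro: finite_subset)
    show ?thesis
      unfolding potential_def 1 by (rule card_Un_disjoint[symmetric]) (use 2 3 finite_nbrs in auto)
  qed
  have "settled (P \<union> J) A' (insert l F)"
    unfolding settled_def
  proof (intro conjI allI impI)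
    show "P \<union> J \<subseteq> V" using PV J by auto
    show "A' \<subseteq> E" using AE Kd E_sym by (auto simp: A'_def)
    show "potential A' ` (P \<union> J) \<subseteq> insert l F" using potP potJ vals by auto
  next
    fix u v assume e: "(u, v) \<in> E" and t: "u \<in> P \<union> J \<or> v \<in> P \<union> J"
    note e' = E_sym[OF e]
    show "(u, v) \<in> A' \<longleftrightarrow> (v, u) \<notin> A'"
    proof (cases "u \<in> P \<or> v \<in> P")
      case True then show ?thesis using dec[OF e True] old by blast
    next
      case False
      then show ?thesis using t e e' outJ inJ by blast
    qed
  next
    fix u v assume "(u, v) \<in> A'"
    then show "u \<in> P \<union> J \<or> v \<in> P \<union> J" using touch by (auto simp: A'_def)
  next
    fix u v assume "(u, v) \<in> A'" "u \<notin> P \<union> J"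
    then show "r v < r u" using par Kd by (auto simp: A'_def)
  next
    fix u v assume "(u, v) \<in> E" "u \<in> P \<union> J" "v \<in> P \<union> J"
    then show "potential A' u \<noteq> potential A' v"
      using JJ separated potP potJ vals l by (metis UnE)
  qed
  then show thesis using potR that by blast
qed

lemma card_parents: "card {v. (j, v) \<in> E \<and> r v < r j} \<le> 2"
proof (cases "j \<in> V")
  case True
  let ?S = "{v. (j, v) \<in> E \<and> r v < r j}"
  have "inj_on c ?S" using parents_rainbow E_sym by (intro inj_onI) blast
  moreover have "c ` ?S \<subseteq> {0, 1, 2} - {c j}"
    using colour_proper colour_lt E_sub by (fastforce simp: less_Suc_eq numeral_3_eq_3)
  ultimately have "card ?S \<le> card ({0, 1, 2::nat} - {c j})"
    by (intro card_inj_on_le) auto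
  also have "\<dots> \<le> 2" using colour_lt[OF True] by (auto simp: less_Suc_eq numeral_3_eq_3)
  finally show ?thesis .
next
  case False
  then have "{v. (j, v) \<in> E \<and> r v < r j} = {}" using E_sub by auto
  then show ?thesis by (simp only: card.empty)
qed

text \<open>
  An edge counted by the potential of \<open>j\<close> leads to an unsettled child, to an unsettled parent, or, if
  it already has a direction, to a settled parent. There are at most two parents.
\<close>

lemma potential_le_kids:
  assumes st: "settled P A F" and j: "j \<in> V - P"
  shows "potential A j \<le> card (kids P j) + 2"
proof -
  have "{v. (j, v) \<in> E \<and> (v, j) \<notin> A} \<subseteq> kids P j \<union> {v. (j, v) \<in> E \<and> r v < r j}"
  proof
    fix v assume "v \<in> {v. (j, v) \<in> E \<and> (v, j) \<notin> A}"
    then have e: "(j, v) \<in> E" and na: "(v, j) \<notin> A" by auto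
    have v: "v \<in> V" using e E_sub by auto
    have ne: "r j \<noteq> r v" using inj_r e v j colour_proper[OF e] by (auto dest: inj_onD)
    show "v \<in> kids P j \<union> {v. (j, v) \<in> E \<and> r v < r j}"
    proof (cases "v \<in> P")
      case True
      then have "(j, v) \<in> A" using st e na unfolding settled_def by blast
      then have "r v < r j" using st j unfolding settled_def by blast
      then show ?thesis using e by auto
    next
      case False
      then show ?thesis using e v ne by (auto simp: kids_def)
    qed
  qed
  then have "potential A j \<le> card (kids P j \<union> {v. (j, v) \<in> E \<and> r v < r j})"
    unfolding potential_def by (rule card_mono[rotated]) (use finite_kids finite_nbrs in auto)
  also have "\<dots> \<le> card (kids P j) + card {v. (j, v) \<in> E \<and> r v < r j}" by (rule card_Un_le)
  also have "\<dots> \<le> card (kids P j) + 2" using card_parents by simp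
  finally show ?thesis .
qed

text \<open>
  A colour class is independent, so all of its vertices that can reach the outdegree \<open>l\<close> may take it
  at once.
\<close>

lemma settle_colour_class:
  assumes st: "settled P A F" and l: "l \<notin> F" "2 \<le> l"
  obtains P' A' where "settled P' A' (insert l F)" "P \<subseteq> P'"
    and "\<And>u. u \<in> V - P' \<Longrightarrow> potential A' u \<le> potential A u"
    and "\<And>u. u \<in> V - P' \<Longrightarrow> c u = a \<Longrightarrow> potential A' u < l"
proof -
  define J where "J = {u \<in> V - P. c u = a \<and> l \<le> potential A u}"
  have "\<exists>K. K \<subseteq> kids P j \<and> potential A j = l + card K" if "j \<in> J" for j
  proof -
    have "potential A j - l \<le> card (kids P j)"
      using potential_le_kids[OF st, of j] that l by (auto simp: J_def)
    then obtain K where "K \<subseteq> kids P j" "card K = potential A j - l"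
      using obtain_subset_with_card_n by metis
    then show ?thesis using that by (auto simp: J_def)
  qed
  then obtain K where K: "\<And>j. j \<in> J \<Longrightarrow> K j \<subseteq> kids P j"
    "\<And>j. j \<in> J \<Longrightarrow> potential A j = l + card (K j)" by metis
  have JV: "J \<subseteq> V - P" by (auto simp: J_def)
  have ind: "indep J" by (auto simp: indep_def J_def dest: colour_proper)
  obtain A' where A': "settled (P \<union> J) A' (insert l F)"
    "\<And>u. u \<in> V - (P \<union> J) \<Longrightarrow>
      potential A' u + card {j \<in> J. (j, u) \<in> E \<and> u \<notin> K j} = potential A u"
    by (rule settle_independent_set[where K = K, OF st JV ind K l(1)]) (assumption | rule that)+
  show thesis
  proof (rule that[OF A'(1)])
    show "P \<subseteq> P \<union> J" by auto
    show le: "potential A' u \<le> potential A u" if "u \<in> V - (P \<union> J)" for u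
      using A'(2)[OF that] by simp
    show "potential A' u < l" if "u \<in> V - (P \<union> J)" "c u = a" for u
      using le[OF that(1)] that by (auto simp: J_def not_le)
  qed
qed

text \<open>
  Removing from a maximum weight independent set \<open>J\<close> all neighbours of \<open>Q\<close> and inserting \<open>Q\<close> cannot
  increase the weight.
\<close>

lemma max_weight_independent_set:
  fixes w :: "'a \<Rightarrow> nat"
  assumes "finite C"
  obtains J where "J \<subseteq> C" "indep J"
    and "\<And>Q. Q \<subseteq> C - J \<Longrightarrow> indep Q \<Longrightarrow> sum w Q \<le> sum w {j \<in> J. \<exists>u\<in>Q. (j, u) \<in> E}"
proof -
  let ?I = "{J. J \<subseteq> C \<and> indep J}"
  have fin: "finite ?I" using assms by auto
  have "{} \<in> ?I" by (auto simp: indep_def)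
  then have "Max (sum w ` ?I) \<in> sum w ` ?I" using fin by (intro Max_in) auto
  then obtain J where "J \<in> ?I" "sum w J = Max (sum w ` ?I)" by auto
  then have J: "J \<in> ?I" "\<And>J'. J' \<in> ?I \<Longrightarrow> sum w J' \<le> sum w J"
    using fin by auto
  show thesis
  proof (rule that)
    show "J \<subseteq> C" "indep J" using J by auto
    fix Q assume Q: "Q \<subseteq> C - J" "indep Q"
    let ?N = "{j \<in> J. \<exists>u\<in>Q. (j, u) \<in> E}"
    have fJ: "finite J" and fQ: "finite Q" using J(1) Q assms by (auto intro: finite_subset)
    have "(J - ?N) \<union> Q \<in> ?I"
      using J(1) Q by (auto simp: indep_def) (blast dest: E_sym)+
    from J(2)[OF this] have "sum w (J - ?N) + sum w Q \<le> sum w J"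
      using Q fJ fQ by (subst (asm) sum.union_disjoint) auto
    moreover have "sum w J = sum w (J - ?N) + sum w ?N"
      using fJ by (intro sum.subset_diff) auto
    ultimately show "sum w Q \<le> sum w ?N" by simp
  qed
qed

text \<open>
  The candidates for the round are the unsettled vertices of potential \<open>l\<close> and those of colour \<open>a\<close> of
  larger potential. Write \<open>e\<close> for the excess \<open>potential A u - l\<close> of a candidate; it is \<open>0\<close> outside
  colour \<open>a\<close>, and where it is positive, the hypothesis says \<open>2 * e + 2 \<le> l\<close>. To drop below \<open>l\<close>, an
  unselected candidate must get edges from
  more than \<open>e\<close> selected neighbours, while a selected one must spare \<open>e\<close> of its children, that is,
  direct the edges from them to itself.

  The weights \<open>2 * e + 1\<close> for \<open>e > 0\<close> and \<open>2\<close> for \<open>e = 0\<close> serve both needs. An unselected candidate of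
  excess \<open>e\<close> has more than \<open>e\<close> selected neighbours (\<open>many\<close>): otherwise exchanging it for them would be
  a gain, for selected neighbours of a vertex with positive excess all have weight \<open>2\<close>. A selected
  vertex \<open>j\<close> of excess \<open>e\<close> must not spare a private child, a candidate whose only
  selected neighbour is \<open>j\<close>. In each colour there are at most \<open>e\<close> private children (\<open>few\<close>), for
  exchanging \<open>j\<close> for \<open>e + 1\<close> of them would be a gain; so there are at most \<open>2 * e\<close>. Since \<open>j\<close> has at
  least \<open>l + e - 2\<close> unsettled children, at least \<open>e\<close> are left to spare.

  A spared candidate has two selected neighbours and loses an edge from only one of them: only
  vertices of colour \<open>a\<close> spare children, and the child has just one parent of that colour. It is itself
  of another colour, hence of excess \<open>0\<close>, so one edge from the other neighbour suffices.
\<close>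

lemma settle_level:
  assumes st: "settled P A F" and l: "l \<notin> F"
    and bound: "\<And>u. u \<in> V - P \<Longrightarrow> c u = a \<Longrightarrow> l < potential A u \<Longrightarrow> 2 * potential A u + 2 \<le> 3 * l"
  obtains P' A' where "settled P' A' (insert l F)" "P \<subseteq> P'"
    and "\<And>u. u \<in> V - P' \<Longrightarrow> potential A' u \<le> potential A u"
    and "\<And>u. u \<in> V - P' \<Longrightarrow> potential A u \<le> l \<or> c u = a \<Longrightarrow> potential A' u < l"
proof -
  define C where "C = {u \<in> V - P. potential A u = l \<or> c u = a \<and> l < potential A u}"
  define w where "w u = (if l < potential A u then 2 * (potential A u - l) + 1 else 2)" for u
  have finC: "finite C" using finite_V by (auto simp: C_def)
  obtain J where JC: "J \<subseteq> C" and ind: "indep J"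
    and exch: "\<And>Q. Q \<subseteq> C - J \<Longrightarrow> indep Q \<Longrightarrow> sum w Q \<le> sum w {j \<in> J. \<exists>u\<in>Q. (j, u) \<in> E}"
    by (fact max_weight_independent_set[OF finC])
  have finJ: "finite J" using JC finC finite_subset by blast
  define N where "N u = {j \<in> J. (j, u) \<in> E}" for u
  have finN: "finite (N u)" for u using finJ by (simp add: N_def)
  have CV: "u \<in> V" "u \<notin> P" "l \<le> potential A u" if "u \<in> C" for u
    using that by (auto simp: C_def)
  have high: "c u = a" if "u \<in> C" "l < potential A u" for u
    using that by (auto simp: C_def)
  have low: "potential A u = l" "w u = 2" if "u \<in> C" "c u \<noteq> a" for u
    using that by (auto simp: C_def w_def)
  have many: "potential A u - l < card (N u)" if u: "u \<in> C - J" for u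
  proof (rule ccontr)
    assume "\<not> ?thesis"
    then have le: "card (N u) \<le> potential A u - l" by simp
    have "indep {u}" by (auto simp: indep_def dest: colour_proper)
    from exch[OF _ this] u have wle: "w u \<le> sum w (N u)"
      by (simp add: N_def)
    show False
    proof (cases "l < potential A u")
      case True
      have "w j = 2" if "j \<in> N u" for j
        using that high[of u] u True JC colour_proper[of j u] by (auto simp: N_def intro!: low)
      then have "sum w (N u) = 2 * card (N u)" by simp
      then show False using wle le True by (simp add: w_def)
    next
      case False
      then have "N u = {}" using le finN by simp
      then show False using wle by (simp add: w_def split: if_splits)
    qed
  qed
  define priv where "priv j = {u \<in> kids P j. u \<in> C \<and> N u = {j}}" for j
  have fpriv: "finite (priv j)" for j using finite_kids by (simp add: priv_def)
  have few: "card {u \<in> priv j. c u = b} \<le> potential A j - l"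
    if j: "j \<in> J" "l < potential A j" for j b
  proof -
    let ?Q = "{u \<in> priv j. c u = b}"
    have e: "(j, u) \<in> E" if "u \<in> ?Q" for u using that by (auto simp: priv_def kids_def)
    have Q: "?Q \<subseteq> C - J"
      using e ind j by (auto simp: priv_def indep_def)
    have "indep ?Q" by (auto simp: indep_def dest: colour_proper)
    from exch[OF Q this] have "sum w ?Q \<le> sum w {v \<in> J. \<exists>u\<in>?Q. (v, u) \<in> E}" .
    also have "\<dots> \<le> sum w {j}"
      by (rule sum_mono2) (auto simp: priv_def N_def)
    also have "\<dots> = 2 * (potential A j - l) + 1" using j by (simp add: w_def)
    finally have "sum w ?Q \<le> 2 * (potential A j - l) + 1" .
    moreover have "w u = 2" if "u \<in> ?Q" for u
      using that e[OF that] high[of j] j JC colour_proper[of j u] Q by (intro low) auto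
    then have "sum w ?Q = 2 * card ?Q" by simp
    ultimately show ?thesis by simp
  qed
  have priv_card: "card (priv j) \<le> 2 * (potential A j - l)"
    if j: "j \<in> J" "l < potential A j" for j
  proof -
    have jV: "j \<in> V" using j JC CV by auto
    \<comment> \<open>the two colours that a child of \<open>j\<close> can have\<close>
    obtain x y where xy: "{0, 1, 2} - {c j} \<subseteq> {x, y::nat}"
      using colour_lt[OF jV] by (cases "c j = 0"; cases "c j = 1"; cases "c j = 2") auto
    have "c u \<in> {x, y}" if "u \<in> priv j" for u
    proof -
      have "(j, u) \<in> E" "u \<in> V" using that by (auto simp: priv_def kids_def)
      then have "c u \<in> {0, 1, 2} - {c j}"
        using colour_proper[of j u] colour_lt[of u] by auto
      then show ?thesis using xy by blast
    qed
    then have "priv j = {u \<in> priv j. c u = x} \<union> {u \<in> priv j. c u = y}" by auto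
    then have "card (priv j) \<le> card {u \<in> priv j. c u = x} + card {u \<in> priv j. c u = y}"
      by (metis card_Un_le)
    then show ?thesis using few[OF j, of x] few[OF j, of y] by simp
  qed
  have "\<exists>K. K \<subseteq> kids P j - priv j \<and> potential A j = l + card K" if j: "j \<in> J" for j
  proof (cases "l < potential A j")
    case True
    have jC: "j \<in> C" using j JC by auto
    have "card (kids P j - priv j) \<ge> card (kids P j) - card (priv j)"
      by (rule diff_card_le_card_Diff) (rule fpriv)
    moreover have "potential A j \<le> card (kids P j) + 2"
      using potential_le_kids[OF st] CV[OF jC] by blast
    moreover have "2 * potential A j + 2 \<le> 3 * l"
      using bound CV[OF jC] high[OF jC] True by blast
    ultimately have "potential A j - l \<le> card (kids P j - priv j)"
      using priv_card[OF j True] by linarith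
    then obtain K where sub: "K \<subseteq> kids P j - priv j" and "card K = potential A j - l"
      using obtain_subset_with_card_n by metis
    then have "potential A j = l + card K" using True by simp
    then show ?thesis using sub by blast
  next
    case False
    then have "potential A j = l" using CV(3)[of j] j JC by auto
    then show ?thesis by (intro exI[of _ "{}"]) auto
  qed
  then have "\<exists>K. \<forall>j\<in>J. K j \<subseteq> kids P j - priv j \<and> potential A j = l + card (K j)"
    by (intro bchoice ballI)
  then obtain K where K: "\<And>j. j \<in> J \<Longrightarrow> K j \<subseteq> kids P j - priv j"
    and Kc: "\<And>j. j \<in> J \<Longrightarrow> potential A j = l + card (K j)" by blast
  have K': "\<And>j. j \<in> J \<Longrightarrow> K j \<subseteq> kids P j" using K by blast
  have JV: "J \<subseteq> V - P" using JC CV by blast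
  obtain A' where A': "settled (P \<union> J) A' (insert l F)"
    and pot: "\<And>u. u \<in> V - (P \<union> J) \<Longrightarrow>
      potential A' u + card {j \<in> J. (j, u) \<in> E \<and> u \<notin> K j} = potential A u"
    by (rule settle_independent_set[where K = K, OF st JV ind K' Kc l]) (assumption | rule that)+
  show thesis
  proof (rule that[OF A'])
    show "P \<subseteq> P \<union> J" by auto
    show le: "potential A' u \<le> potential A u" if "u \<in> V - (P \<union> J)" for u
      using pot[OF that] by simp
    fix u assume u: "u \<in> V - (P \<union> J)" and hyp: "potential A u \<le> l \<or> c u = a"
    show "potential A' u < l"
    proof (cases "u \<in> C")
      case False
      then have "potential A u < l" using u hyp by (auto simp: C_def)
      then show ?thesis using le[OF u] by simp
    next
      case True
      then have uC: "u \<in> C - J" using u by auto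
      show ?thesis
      proof (cases "\<exists>j\<in>J. u \<in> K j")
        case False
        then have "{j \<in> J. (j, u) \<in> E \<and> u \<notin> K j} = N u" by (auto simp: N_def)
        then show ?thesis using pot[OF u] many[OF uC] CV(3)[OF True] by simp
      next
        case ex: True
        then obtain j where j: "j \<in> J" "u \<in> K j" by blast
        \<comment> \<open>a vertex that spares children has positive excess, hence colour \<open>a\<close>\<close>
        have kid: "(i, u) \<in> E \<and> r i < r u \<and> c i = a" if "i \<in> J" "u \<in> K i" for i
        proof -
          have "finite (K i)" using K'[OF that(1)] finite_kids finite_subset by blast
          then have "card (K i) > 0" using that(2) by (auto simp: card_gt_0_iff)
          then have "c i = a" using Kc[OF that(1)] high[of i] JC that(1) by auto
          then show ?thesis using K'[OF that(1)] that(2) by (auto simp: kids_def)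
        qed
        have uniq: "i = j" if "i \<in> J" "u \<in> K i" for i
          using kid[OF that] kid[OF j] parents_rainbow[of i u j] by auto
        have jN: "j \<in> N u" using kid[OF j] j by (auto simp: N_def)
        have "u \<notin> priv j" "u \<in> kids P j" using K[OF j(1)] j(2) by auto
        then have "N u \<noteq> {j}" using True by (auto simp: priv_def)
        then obtain i where "i \<in> N u" "i \<noteq> j" using jN by blast
        moreover have "{i \<in> J. (i, u) \<in> E \<and> u \<notin> K i} = N u - {j}"
          using uniq j unfolding N_def by blast
        ultimately have "card {i \<in> J. (i, u) \<in> E \<and> u \<notin> K i} > 0"
          using finN by (auto simp: card_gt_0_iff)
        moreover have "potential A u = l"
          using kid[OF j] colour_proper[of j u] by (intro low True) auto
        ultimately show ?thesis using pot[OF u] by linarith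
      qed
    qed
  qed
qed

text \<open>
  If all potentials are below \<open>l\<close>, the excess in \<open>settle_level\<close> vanishes, and a round with value \<open>l - 1\<close>
  lowers all potentials below \<open>l - 1\<close>; so the rounds with the values from \<open>l - 1\<close> down to \<open>0\<close> settle every vertex.
\<close>

lemma settle_all:
  assumes "settled P A F" "\<And>u. u \<in> V - P \<Longrightarrow> potential A u < l" "F \<subseteq> {l..m}" "l \<le> Suc m"
  shows "\<exists>A'. settled V A' {..m}"
  using assms
proof (induction l arbitrary: P A F)
  case 0
  have "V - P = {}" using 0(2) by auto
  moreover have "P \<subseteq> V" using 0(1) by (simp add: settled_def)
  ultimately have "P = V" by blast
  moreover have "settled P A {..m}"
    using 0(1) 0(3) unfolding settled_def by (meson atLeastatMost_subset_iff atMost_iff atLeastAtMost_iff subset_iff)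
  ultimately show ?case by blast
next
  case (Suc l)
  have F: "l \<notin> F" using Suc.prems(3) by auto
  have le: "potential A u \<le> l" if "u \<in> V - P" for u using Suc.prems(2)[OF that] by simp
  have bd: "2 * potential A u + 2 \<le> 3 * l" if "u \<in> V - P" "c u = 0" "l < potential A u" for u
    using le[OF that(1)] that(3) by simp
  obtain P' A' where s: "settled P' A' (insert l F)" "P \<subseteq> P'"
    and m': "\<And>u. u \<in> V - P' \<Longrightarrow> potential A' u \<le> potential A u"
    and p: "\<And>u. u \<in> V - P' \<Longrightarrow> potential A u \<le> l \<or> c u = 0 \<Longrightarrow> potential A' u < l"
    by (rule settle_level[OF Suc.prems(1) F bd]) (assumption | rule that)+
  show ?case
  proof (rule Suc.IH[OF s(1)])
    show "potential A' u < l" if "u \<in> V - P'" for u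
      using p[OF that] le[of u] that s(2) by auto
    show "insert l F \<subseteq> {l..m}" using Suc.prems(3,4) by auto
    show "l \<le> Suc m" using Suc.prems(4) by simp
  qed
qed

text \<open>
  Once the colours 0, 1, 2 have been settled down from 8, 9, 10, the potentials are at most 7, 8, 9.
  The round with value 7 admits excess 2 only in one colour, which is colour 2; colour 1 may keep the
  potentials 7 and 8 in this round, and they are excess 1 and 2 for the round with value 6.
  There \<open>2 * 2 + 2 \<le> 6\<close> holds with equality.
\<close>

theorem settled_at_most_10:
  obtains A where "settled V A {..10}"
proof -
  have n8: "8 \<notin> ({} :: nat set)" "2 \<le> (8::nat)"
    and n9: "9 \<notin> {8::nat}" "2 \<le> (9::nat)"
    and n10: "10 \<notin> {9, 8::nat}" "2 \<le> (10::nat)"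
    and n7: "7 \<notin> {10, 9, 8::nat}"
    and n6: "6 \<notin> {7, 10, 9, 8::nat}" by simp_all
  obtain P1 A1 where s1: "settled P1 A1 {8}" "{} \<subseteq> P1"
    and m1: "\<And>u. u \<in> V - P1 \<Longrightarrow> potential A1 u \<le> potential {} u"
    and p1: "\<And>u. u \<in> V - P1 \<Longrightarrow> c u = 0 \<Longrightarrow> potential A1 u < 8"
    by (fact settle_colour_class[OF settled_empty n8(1) n8(2), where a = 0])
  obtain P2 A2 where s2: "settled P2 A2 {9, 8}" "P1 \<subseteq> P2"
    and m2: "\<And>u. u \<in> V - P2 \<Longrightarrow> potential A2 u \<le> potential A1 u"
    and p2: "\<And>u. u \<in> V - P2 \<Longrightarrow> c u = 1 \<Longrightarrow> potential A2 u < 9"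
    by (fact settle_colour_class[OF s1(1) n9(1) n9(2), where a = 1])
  obtain P3 A3 where s3: "settled P3 A3 {10, 9, 8}" "P2 \<subseteq> P3"
    and m3: "\<And>u. u \<in> V - P3 \<Longrightarrow> potential A3 u \<le> potential A2 u"
    and p3: "\<And>u. u \<in> V - P3 \<Longrightarrow> c u = 2 \<Longrightarrow> potential A3 u < 10"
    by (fact settle_colour_class[OF s2(1) n10(1) n10(2), where a = 2])
  have b0: "potential A3 u \<le> 7" if "u \<in> V - P3" "c u = 0" for u
  proof -
    have "u \<in> V - P1" "u \<in> V - P2" using that(1) s2(2) s3(2) by auto
    then show ?thesis using p1[of u] m2[of u] m3[of u] that by linarith
  qed
  have b1: "potential A3 u \<le> 8" if "u \<in> V - P3" "c u = 1" for u
  proof -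
    have "u \<in> V - P2" using that(1) s3(2) by auto
    then show ?thesis using p2[of u] m3[of u] that by linarith
  qed
  have c4: "2 * potential A3 u + 2 \<le> 3 * 7" if "u \<in> V - P3" "c u = 2" "7 < potential A3 u" for u
    using p3[OF that(1,2)] by simp
  obtain P4 A4 where s4: "settled P4 A4 {7, 10, 9, 8}" "P3 \<subseteq> P4"
    and m4: "\<And>u. u \<in> V - P4 \<Longrightarrow> potential A4 u \<le> potential A3 u"
    and p4: "\<And>u. u \<in> V - P4 \<Longrightarrow> potential A3 u \<le> 7 \<or> c u = 2 \<Longrightarrow> potential A4 u < 7"
    by (rule settle_level[OF s3(1) n7 c4]) (assumption | rule that)+
  have b4: "potential A4 u \<le> 6" if "u \<in> V - P4" "c u \<noteq> 1" for u
  proof -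
    have "c u = 0 \<or> c u = 2" using colour_lt[of u] that by auto
    moreover have "u \<in> V - P3" using that(1) s4(2) by auto
    ultimately have "potential A3 u \<le> 7 \<or> c u = 2" using b0 by blast
    then show ?thesis using p4[OF that(1)] by simp
  qed
  have b4': "potential A4 u \<le> 8" if "u \<in> V - P4" "c u = 1" for u
  proof -
    have "u \<in> V - P3" using that(1) s4(2) by auto
    then show ?thesis using b1[of u] m4[of u] that by linarith
  qed
  have c5: "2 * potential A4 u + 2 \<le> 3 * 6" if "u \<in> V - P4" "c u = 1" "6 < potential A4 u" for u
    using b4'[OF that(1,2)] by simp
  obtain P5 A5 where s5: "settled P5 A5 {6, 7, 10, 9, 8}" "P4 \<subseteq> P5"
    and m5: "\<And>u. u \<in> V - P5 \<Longrightarrow> potential A5 u \<le> potential A4 u"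
    and p5: "\<And>u. u \<in> V - P5 \<Longrightarrow> potential A4 u \<le> 6 \<or> c u = 1 \<Longrightarrow> potential A5 u < 6"
    by (rule settle_level[OF s4(1) n6 c5]) (assumption | rule that)+
  have lt: "potential A5 u < 6" if "u \<in> V - P5" for u
    using p5[OF that] b4[of u] that s5(2) by blast
  have F: "{6, 7, 10, 9, 8::nat} \<subseteq> {6..10}" "(6::nat) \<le> Suc 10" by simp_all
  show thesis
    using settle_all[OF s5(1) lt F] that by blast
qed

lemma settled_proper_orientation:
  assumes G: "pverts G = V" "parcs G = E" and A: "settled V A {..m}"
  shows "proper_orientation_of G \<lparr>pverts = V, parcs = A\<rparr>"
    and "max_out_degree \<lparr>pverts = V, parcs = A\<rparr> \<le> m"
proof -
  let ?D = "\<lparr>pverts = V, parcs = A\<rparr>"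
  have AE: "A \<subseteq> E" using A by (simp add: settled_def)
  have dec: "(u, v) \<in> A \<longleftrightarrow> (v, u) \<notin> A" if e: "(u, v) \<in> E" for u v
  proof -
    have "u \<in> V \<or> v \<in> V" using e E_sub by auto
    then show ?thesis using A e unfolding settled_def by blast
  qed
  have deg: "out_degree (with_proj ?D) u = potential A u" for u
  proof -
    have "out_arcs (with_proj ?D) u = Pair u ` {v. (u, v) \<in> E \<and> (v, u) \<notin> A}"
      using AE dec by (auto simp: out_arcs_def)
    then show ?thesis
      unfolding out_degree_def potential_def by (simp add: card_image inj_on_def)
  qed
  have "orientation_of G ?D"
    unfolding orientation_of_def using G AE dec by auto
  moreover have "potential A u \<noteq> potential A v" if e: "(u, v) \<in> E" for u v
  proof -
    have "u \<in> V" "v \<in> V" using e E_sub by auto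
    then show ?thesis using A e unfolding settled_def by blast
  qed
  ultimately show "proper_orientation_of G ?D"
    unfolding proper_orientation_of_def deg using G by auto
  have "potential A ` V \<subseteq> {..m}" using A by (simp add: settled_def)
  then show "max_out_degree ?D \<le> m"
    unfolding max_out_degree_def deg using finite_V by auto
qed

end

section \<open>Graphs of tree-width at most two\<close>

theorem corollary1p6:
  fixes G :: "'a pair_pre_digraph"
  assumes "pair_graph G"
    and "tree_width G \<le> 2"
  shows "proper_orientation_number G \<le> 10"
proof -
  interpret G: pair_graph G by fact
  obtain T X where dec: "tree_decomposition G T X" and "decomposition_width T X = tree_width G"
    using tree_width_attained[OF assms(1)] by blast
  then have width: "decomposition_width T X \<le> 2" using assms(2) by simp
  have "pair_graph T" using dec by (simp add: tree_decomposition_def undirected_tree_def)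
  then interpret T: pair_graph T .
  have bag: "card (X t) \<le> 3" if t: "t \<in> pverts T" for t
  proof -
    have "int (card (X t)) - 1 \<le> decomposition_width T X"
      unfolding decomposition_width_def using t T.pair_finite_verts by (intro Max_ge) auto
    then show ?thesis using width by simp
  qed
  obtain r c where R: "rainbow_order_on X (pverts T) r c"
    using rainbow_order_of_tree_decomposition[OF dec G.pair_finite_verts bag] by blast
  have cover: "\<Union>(X ` pverts T) = pverts G"
    using dec by (simp add: tree_decomposition_def)
  have edge: "\<exists>t\<in>pverts T. u \<in> X t \<and> v \<in> X t" if "(u, v) \<in> parcs G" for u v
    using dec that unfolding tree_decomposition_def by blast
  have r_inj: "inj_on r (pverts G)" and c_lt: "\<And>v. v \<in> pverts G \<Longrightarrow> c v < 3"
    and c_inj: "\<And>t. t \<in> pverts T \<Longrightarrow> inj_on c (X t)"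
    using R unfolding rainbow_order_on_def cover by blast+
  interpret rainbow_ordered_graph "pverts G" "parcs G" r c
  proof
    show "finite (pverts G)" by (rule G.pair_finite_verts)
    show "parcs G \<subseteq> pverts G \<times> pverts G" using G.in_arcsD1 G.in_arcsD2 by auto
    show "(v, u) \<in> parcs G" if "(u, v) \<in> parcs G" for u v by (rule G.arcs_symmetric[OF that])
    show "inj_on r (pverts G)" by (rule r_inj)
    show "c v < 3" if "v \<in> pverts G" for v by (rule c_lt[OF that])
    show "c u \<noteq> c v" if e: "(u, v) \<in> parcs G" for u v
    proof -
      obtain t where t: "t \<in> pverts T" "u \<in> X t" "v \<in> X t" using edge[OF e] by blast
      have "u \<noteq> v" using G.no_loops'[OF e] .
      then show ?thesis using inj_onD[OF c_inj[OF t(1)], of u v] t by blast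
    qed
    show "u = u'" if e: "(u, v) \<in> parcs G" "(u', v) \<in> parcs G"
      and lt: "r u < r v" "r u' < r v" "c u = c u'" for u v u'
    proof -
      obtain t where "t \<in> pverts T" "u \<in> X t" "v \<in> X t" using edge[OF e(1)] by blast
      moreover obtain t' where "t' \<in> pverts T" "u' \<in> X t'" "v \<in> X t'" using edge[OF e(2)] by blast
      ultimately show ?thesis using R lt unfolding rainbow_order_on_def by blast
    qed
  qed
  obtain A where A: "settled (pverts G) A {..10}" by (fact settled_at_most_10)
  let ?D = "\<lparr>pverts = pverts G, parcs = A\<rparr>"
  have "proper_orientation_of G ?D" and "max_out_degree ?D \<le> 10"
    using settled_proper_orientation[OF _ _ A] by auto
  then show ?thesis
    unfolding proper_orientation_number_def by (intro order.trans[OF Least_le]) auto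
qed

end
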